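(* There are no blue $K_5$'s in $\mathrm{Cyclic}(43)$.
   Context: $\mathrm{Cyclic}(43)$ is the red/blue edge colouring of the complete graph $K_{43}$ on vertices $0,1,\dots,42$ (labels read modulo $43$) defined as follows. For distinct vertices $a,b$, the distance $\mathrm{d}(a,b)$ is the unique $m\in\{1,\dots,21\}$ with $a-b\equiv m$ or $b-a\equiv m \pmod{43}$. The edge between $a$ and $b$ is red if $\mathrm{d}(a,b)\in\{1,2,7,10,12,13,14,16,18,20,21\}$ and blue if $\mathrm{d}(a,b)\in\{3,4,5,6,8,9,11,15,17,19\}$. A blue $K_5$ is a set of five distinct vertices all ten of whose edges are blue. *)

theory Defs
  imports "HOL-Number_Theory.Cong"
begin

definition cyclic43_vertices :: "int set" where
  "cyclic43_vertices = {0..42}"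

definition cyclic43_dist :: "int \<Rightarrow> int \<Rightarrow> int" where
  "cyclic43_dist a b =
     (THE m. m \<in> {1..21} \<and> ([a - b = m] (mod 43) \<or> [b - a = m] (mod 43)))"

definition cyclic43_red :: "int \<Rightarrow> int \<Rightarrow> bool" where
  "cyclic43_red a b \<longleftrightarrow> a \<in> cyclic43_vertices \<and> b \<in> cyclic43_vertices \<and> a \<noteq> b \<and>
     cyclic43_dist a b \<in> {1, 2, 7, 10, 12, 13, 14, 16, 18, 20, 21}"

definition cyclic43_blue :: "int \<Rightarrow> int \<Rightarrow> bool" where
  "cyclic43_blue a b \<longleftrightarrow> a \<in> cyclic43_vertices \<and> b \<in> cyclic43_vertices \<and> a \<noteq> b \<and>
     cyclic43_dist a b \<in> {3, 4, 5, 6, 8, 9, 11, 15, 17, 19}"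

definition cyclic43_blue_K5 :: "int set \<Rightarrow> bool" where
  "cyclic43_blue_K5 S \<longleftrightarrow> S \<subseteq> cyclic43_vertices \<and> card S = 5 \<and>
     (\<forall>a\<in>S. \<forall>b\<in>S. a \<noteq> b \<longrightarrow> cyclic43_blue a b)"

(* The definite description in cyclic43_dist is justified for distinct vertices. *)
lemma cyclic43_dist_unique:
  assumes "a \<in> cyclic43_vertices" "b \<in> cyclic43_vertices" "a \<noteq> b"
  shows "\<exists>!m. m \<in> {1..21} \<and> ([a - b = m] (mod 43) \<or> [b - a = m] (mod 43))"
proof -
  have bnd: "0 \<le> a" "a \<le> 42" "0 \<le> b" "b \<le> 42"
    using assms by (auto simp: cyclic43_vertices_def)
  define m where "m = min \<bar>a - b\<bar> (43 - \<bar>a - b\<bar>)"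
  have m: "1 \<le> m" "m \<le> 21"
    using bnd assms(3) unfolding m_def by linarith+
  have key: "([a - b = k] (mod 43) \<or> [b - a = k] (mod 43)) \<longleftrightarrow> k = m"
    if k: "1 \<le> k" "k \<le> 21" for k
  proof -
    have "[x = k] (mod 43) \<longleftrightarrow> x = k \<or> x = k - 43" if "\<bar>x\<bar> \<le> 42" for x
    proof
      assume "[x = k] (mod 43)"
      then have "43 dvd x - k" by (simp add: cong_iff_dvd_diff)
      then obtain q where "x - k = 43 * q" by (rule dvdE)
      moreover have "q = 0 \<or> q = - 1"
        using calculation that k by linarith
      ultimately show "x = k \<or> x = k - 43" by auto
    qed (auto simp: cong_iff_dvd_diff)
    from this[of "a - b"] this[of "b - a"] show ?thesis
      using bnd k m unfolding m_def by (smt (verit))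
  qed
  show ?thesis
    using key m by (metis atLeastAtMost_iff)
qed

lemma cyclic43_dist_commute: "cyclic43_dist a b = cyclic43_dist b a"
  unfolding cyclic43_dist_def by (simp add: disj_commute)

lemma cyclic43_colouring:
  assumes "a \<in> cyclic43_vertices" "b \<in> cyclic43_vertices" "a \<noteq> b"
  shows "cyclic43_red a b \<longleftrightarrow> \<not> cyclic43_blue a b"
proof -
  have "cyclic43_dist a b \<in> {1..21}"
    using theI'[OF cyclic43_dist_unique[OF assms]] unfolding cyclic43_dist_def by blast
  then have "1 \<le> cyclic43_dist a b" "cyclic43_dist a b \<le> 21" by simp_all
  then show ?thesis
    using assms unfolding cyclic43_red_def cyclic43_blue_def insert_iff empty_iff
    by presburger
qed

end

theory Submission
  imports Defs
begin

text \<open>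
  The edge between vertices \<open>a < b\<close> is blue only if the integer \<open>b - a\<close> is congruent modulo 43 to
  plus or minus one of the ten blue distances, which leaves twenty possible values for \<open>b - a\<close>
  (\<open>blue_imp_difference\<close>). The colour of an edge is thus invariant under translation, and after
  subtracting the least vertex a blue \<open>K\<^sub>5\<close> becomes \<open>0 < w < x < y < z\<close> where \<open>w\<close>, \<open>x\<close>, \<open>y\<close>, \<open>z\<close> and
  all their differences are among these twenty values. Without the translation one would have to
  inspect nearly a million sets of five vertices; now the search is small, because each choice cuts
  down the candidates for the later ones: there are 90 admissible pairs \<open>w < x\<close> and 100 admissible
  triples \<open>w < x < y\<close>, and none of the triples extends to a fourth element
  (\<open>no_four_with_blue_differences\<close>).
\<close>

definition blue_differences :: "int list" where
  "blue_differences =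
     [3, 4, 5, 6, 8, 9, 11, 15, 17, 19, 24, 26, 28, 32, 34, 35, 37, 38, 39, 40]"

text \<open>
  Both \<open>b - a\<close> and the distance \<open>m\<close> are smaller than 43, so the congruence that characterises \<open>m\<close>
  leaves only \<open>b - a = m\<close> and \<open>b - a = 43 - m\<close>.
\<close>

lemma blue_imp_difference:
  assumes "cyclic43_blue a b" and "a < b"
  shows "b - a \<in> set blue_differences"
proof -
  define m where "m = cyclic43_dist a b"
  have ab: "0 \<le> a" "b \<le> 42"
    and vs: "a \<in> cyclic43_vertices" "b \<in> cyclic43_vertices" "a \<noteq> b"
    and blue: "m \<in> {3, 4, 5, 6, 8, 9, 11, 15, 17, 19}"
    using assms by (auto simp: cyclic43_blue_def cyclic43_vertices_def m_def)
  have m: "m \<in> {1..21} \<and> ([a - b = m] (mod 43) \<or> [b - a = m] (mod 43))"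
    using theI'[OF cyclic43_dist_unique[OF vs]] unfolding cyclic43_dist_def m_def .
  have bounds: "0 < b - a" "b - a \<le> 42" "1 \<le> m" "m \<le> 21"
    using ab assms(2) m by auto
  have "b - a = 43 - m \<or> b - a = m"
    using m
  proof (elim conjE disjE)
    assume "[a - b = m] (mod 43)"
    then obtain k where "a - b - m = 43 * k"
      unfolding cong_iff_dvd_diff by (rule dvdE)
    moreover from this have "k = - 1"
      using bounds by linarith
    ultimately show ?thesis by simp
  next
    assume "[b - a = m] (mod 43)"
    then obtain k where "b - a - m = 43 * k"
      unfolding cong_iff_dvd_diff by (rule dvdE)
    moreover from this have "k = 0"
      using bounds by linarith
    ultimately show ?thesis by simp
  qed
  then show ?thesis
    using blue by (auto simp: blue_differences_def)
qed

text \<open>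
  The search is a computation by rewriting with the code equations. The successive candidate lists
  keep it short: after each choice only the candidates compatible with it survive.
\<close>

lemma no_four_with_blue_differences_search:
  "list_all (\<lambda>w. let ws = filter (\<lambda>v. v - w \<in> set blue_differences) blue_differences in
     list_all (\<lambda>x. let xs = filter (\<lambda>v. v - x \<in> set blue_differences) ws in
       list_all (\<lambda>y. filter (\<lambda>v. v - y \<in> set blue_differences) xs = []) xs) ws)
     blue_differences"
  by code_simp

lemma no_four_with_blue_differences:
  assumes "{w, x, y, z} \<subseteq> set blue_differences"
    and "{x - w, y - w, z - w, y - x, z - x, z - y} \<subseteq> set blue_differences"
  shows False
  using assms no_four_with_blue_differences_search
  by (auto simp: Let_def list_all_iff filter_empty_conv)

theorem mainTheorem3:
  shows "\<not> (\<exists>S. cyclic43_blue_K5 S)"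
proof
  assume "\<exists>S. cyclic43_blue_K5 S"
  then obtain S where card: "card S = 5"
    and blue: "\<And>a b. a \<in> S \<Longrightarrow> b \<in> S \<Longrightarrow> a \<noteq> b \<Longrightarrow> cyclic43_blue a b"
    unfolding cyclic43_blue_K5_def by blast
  define vs where "vs = sorted_list_of_set S"
  have "finite S"
    using card card.infinite by fastforce
  then have vs: "length vs = 5" "sorted_wrt (<) vs" "set vs = S"
    using card by (simp_all add: vs_def)
  then obtain a b c d e where "vs = [a, b, c, d, e]"
    by (auto simp: eval_nat_numeral length_Suc_conv)
  with vs have ord: "a < b" "b < c" "c < d" "d < e" and S: "S = {a, b, c, d, e}"
    by auto
  have diff: "q - p \<in> set blue_differences" if "p \<in> S" "q \<in> S" "p < q" for p q
    using blue_imp_difference[OF blue] that by simp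
  have "{b - a, c - a, d - a, e - a} \<subseteq> set blue_differences"
    using ord by (auto intro!: diff simp: S)
  moreover have "{(c - a) - (b - a), (d - a) - (b - a), (e - a) - (b - a),
      (d - a) - (c - a), (e - a) - (c - a), (e - a) - (d - a)} \<subseteq> set blue_differences"
    using ord by (auto intro!: diff simp: S)
  ultimately show False
    by (rule no_four_with_blue_differences)
qed

end
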